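(* Let $\mu=\mu_{1/4}$, $\Gamma=\{\sum_{i=0}^m a_i4^i: m\ge0,\ a_i\in\{0,1\}\}$, let $U$ be the unitary operator on $L^2(\mu)$ determined by $Ue_\gamma=e_{5\gamma}$ for $\gamma\in\Gamma$, and let $W_0$ be the closed span of $\{e_\gamma:\gamma\in\Gamma_0\}$, where $\Gamma_0=1+4\Gamma$. Order the index set $\Gamma_0$ of the orthonormal basis of $W_0$ by the partition $\Gamma_0=\{1\}\cup\bigsqcup_{k\ge0}\widetilde\Gamma_k$ with $\widetilde\Gamma_k=1+4^{k+1}(1+4\Gamma)$. Then the matrix of $U|_{W_0}$ has the block form $$\begin{array}{c|cccccc} & 1&\widetilde\Gamma_0&\widetilde\Gamma_1&\widetilde\Gamma_2&\widetilde\Gamma_3&\cdots\\\hline 1&0&*&0&0&0&\cdots\\ \widetilde\Gamma_0&*&0&*&*&*&\cdots\\ \widetilde\Gamma_1&0&*&0&0&0&\cdots\\ \widetilde\Gamma_2&0&*&0&0&0&\cdots\\ \widetilde\Gamma_3&0&*&0&0&0&\cdots\\ \vdots&\vdots&\vdots&\vdots&\vdots&\vdots&\ddots\end{array}$$ where $0$ indicates an entry or block all of whose entries are zero and $*$ indicates an entry or block that is not necessarily zero. That is, the blocks $(1,1)$, $(\widetilde\Gamma_0,\widetilde\Gamma_0)$, $(1,\widetilde\Gamma_k)$ and $(\widetilde\Gamma_k,1)$ for $k\ge1$, and $(\widetilde\Gamma_i,\widetilde\Gamma_j)$ for $i,j\ge1$ are all zero, while the blocks $(1,\widetilde\Gamma_0)$,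 $(\widetilde\Gamma_0,1)$, $(\widetilde\Gamma_0,\widetilde\Gamma_k)$ and $(\widetilde\Gamma_k,\widetilde\Gamma_0)$ for $k\ge1$ are not required to be zero.
   Context: $\mu_{1/4}$ is the unique Borel probability measure on $\mathbb{R}$ satisfying $\mu=\frac12\mu\circ\tau_+^{-1}+\frac12\mu\circ\tau_-^{-1}$ with $\tau_\pm(x)=\frac14(x\pm1)$. For $t\in\mathbb{R}$, $e_t(x)=e^{2\pi i t x}$ in $L^2(\mu)$. It is a known fact (to be taken as given) that both $\{e_\gamma:\gamma\in\Gamma\}$ and $\{e_{5\gamma}:\gamma\in\Gamma\}$ are orthonormal bases of $L^2(\mu_{1/4})$, so $U$ is well defined and unitary; $W_0$ is invariant under $U$. For $\xi',\gamma'\in\Gamma_0$ the $(\xi',\gamma')$ entry (row $\xi'$, column $\gamma'$) of the matrix of $U|_{W_0}$ is $U|_{W_0}(\xi',\gamma')=\langle e_{\xi'},Ue_{\gamma'}\rangle=\widehat\mu(5\gamma'-\xi')$, where $\widehat\mu(t)=\int e^{2\pi i xt}\,d\mu(x)$ (a real, even function). *)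

theory Defs
  imports "HOL-Probability.Probability"
begin

definition tau_plus :: "real \<Rightarrow> real" where
  "tau_plus x = (x + 1) / 4"

definition tau_minus :: "real \<Rightarrow> real" where
  "tau_minus x = (x - 1) / 4"

text \<open>The defining property of \<open>\<mu>\<^sub>1\<^sub>/\<^sub>4\<close>; there is exactly one such measure.\<close>

definition is_mu_quarter :: "real measure \<Rightarrow> bool" where
  "is_mu_quarter M \<longleftrightarrow> prob_space M \<and> sets M = sets borel \<and>
     (\<forall>A\<in>sets borel. measure M A =
        1/2 * measure (distr M borel tau_plus) A + 1/2 * measure (distr M borel tau_minus) A)"

text \<open>\<open>L\<^sup>2(M)\<close> is represented by square integrable functions; equality in \<open>L\<^sup>2(M)\<close> is
  equality almost everywhere.\<close>

definition L2 :: "'a measure \<Rightarrow> ('a \<Rightarrow> complex) set" where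
  "L2 M = {f \<in> borel_measurable M. integrable M (\<lambda>x. (cmod (f x))\<^sup>2)}"

text \<open>Conjugate-linear in the first argument.\<close>

definition L2_inner :: "'a measure \<Rightarrow> ('a \<Rightarrow> complex) \<Rightarrow> ('a \<Rightarrow> complex) \<Rightarrow> complex" where
  "L2_inner M f g = (\<integral>x. cnj (f x) * g x \<partial>M)"

definition L2_norm :: "'a measure \<Rightarrow> ('a \<Rightarrow> complex) \<Rightarrow> real" where
  "L2_norm M f = sqrt (\<integral>x. (cmod (f x))\<^sup>2 \<partial>M)"

text \<open>An operator on \<open>L\<^sup>2(M)\<close> is a map on representatives that respects equality almost
  everywhere.\<close>

definition L2_unitary ::
    "'a measure \<Rightarrow> (('a \<Rightarrow> complex) \<Rightarrow> ('a \<Rightarrow> complex)) \<Rightarrow> bool" where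
  "L2_unitary M U \<longleftrightarrow>
     (\<forall>f\<in>L2 M. U f \<in> L2 M) \<and>
     (\<forall>f\<in>L2 M. \<forall>g\<in>L2 M. (AE x in M. f x = g x) \<longrightarrow> (AE x in M. U f x = U g x)) \<and>
     (\<forall>f\<in>L2 M. \<forall>g\<in>L2 M. AE x in M. U (\<lambda>y. f y + g y) x = U f x + U g x) \<and>
     (\<forall>c. \<forall>f\<in>L2 M. AE x in M. U (\<lambda>y. c * f y) x = c * U f x) \<and>
     (\<forall>f\<in>L2 M. \<forall>g\<in>L2 M. L2_inner M (U f) (U g) = L2_inner M f g) \<and>
     (\<forall>g\<in>L2 M. \<exists>f\<in>L2 M. AE x in M. U f x = g x)"

definition L2_closed_span :: "'a measure \<Rightarrow> ('a \<Rightarrow> complex) set \<Rightarrow> ('a \<Rightarrow> complex) set" where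
  "L2_closed_span M S = {f \<in> L2 M. \<forall>\<epsilon>>0. \<exists>F c. finite F \<and> F \<subseteq> S \<and>
     L2_norm M (\<lambda>x. f x - (\<Sum>g\<in>F. c g * g x)) < \<epsilon>}"

definition expo :: "real \<Rightarrow> real \<Rightarrow> complex" where
  "expo t x = exp (2 * of_real pi * \<i> * of_real t * of_real x)"

definition Gam :: "nat set" where
  "Gam = {(\<Sum>i\<le>m. a i * 4 ^ i) | m a. \<forall>i\<le>m. a i \<in> {0, 1}}"

definition Gam0 :: "nat set" where
  "Gam0 = (\<lambda>\<gamma>. 1 + 4 * \<gamma>) ` Gam"

text \<open>\<open>Gam_tilde k\<close> is \<open>1 + 4\<^bsup>k+1\<^esup>(1 + 4\<Gamma>)\<close>.\<close>

definition Gam_tilde :: "nat \<Rightarrow> nat set" where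
  "Gam_tilde k = (\<lambda>\<gamma>. 1 + 4 ^ (k + 1) * \<gamma>) ` Gam0"

definition W0 :: "real measure \<Rightarrow> (real \<Rightarrow> complex) set" where
  "W0 M = L2_closed_span M ((\<lambda>\<gamma>. expo (real \<gamma>)) ` Gam0)"

text \<open>The matrix, with respect to the exponentials, of an operator \<open>T\<close>:
  row index first, column index second.\<close>

definition expo_matrix ::
    "real measure \<Rightarrow> ((real \<Rightarrow> complex) \<Rightarrow> (real \<Rightarrow> complex)) \<Rightarrow> nat \<Rightarrow> nat \<Rightarrow> complex" where
  "expo_matrix M T \<xi> \<gamma> = L2_inner M (expo (real \<xi>)) (T (expo (real \<gamma>)))"

definition zero_block :: "(nat \<Rightarrow> nat \<Rightarrow> complex) \<Rightarrow> nat set \<Rightarrow> nat set \<Rightarrow> bool" where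
  "zero_block A R C \<longleftrightarrow> (\<forall>\<xi>\<in>R. \<forall>\<gamma>\<in>C. A \<xi> \<gamma> = 0)"

end

theory Submission
  imports Defs
begin

text \<open>Since \<open>\<mu>\<close> is the average of its images under \<open>\<tau>\<^sub>\<plusminus>\<close>, its Fourier transform satisfies
  \<open>\<mu>\<^sup>^(t) = cos (\<pi>t/2) \<mu>\<^sup>^(t/4)\<close>. Hence \<open>\<mu>\<^sup>^(4n) = \<mu>\<^sup>^(n) = 0\<close> for every odd integer \<open>n\<close>, and in each
  of the blocks claimed to vanish all numbers \<open>5\<gamma>' - \<xi>'\<close> are of the form \<open>4n\<close> with \<open>n\<close> odd.\<close>

section \<open>Self-similarity as an identity of measures and integrals\<close>

text \<open>An equal-weight mixture of two image measures is the law obtained when an independent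
  fair coin selects the map. Fubini splits the integral over the two outcomes; the bound
  \<open>B\<close> gives integrability on the product probability space.\<close>

lemma integral_distr_bernoulli_half_pair:
  fixes f :: "real \<Rightarrow> 'b::{banach, second_countable_topology}" and g h :: "real \<Rightarrow> real"
  assumes "prob_space M" and sM[measurable_cong]: "sets M = sets borel"
    and [measurable]: "g \<in> borel_measurable borel" "h \<in> borel_measurable borel"
      "f \<in> borel_measurable borel"
    and bounded: "\<And>x. norm (f x) \<le> B"
  shows "(\<integral>x. f x \<partial>distr (measure_pmf (bernoulli_pmf (1/2)) \<Otimes>\<^sub>M M) borel
            (\<lambda>(b, x). if b then g x else h x)) =
         (1/2) *\<^sub>R (\<integral>x. f (g x) \<partial>M) + (1/2) *\<^sub>R (\<integral>x. f (h x) \<partial>M)"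
proof -
  interpret M: prob_space M by fact
  interpret P: pair_prob_space "measure_pmf (bernoulli_pmf (1/2))" M ..
  let ?P = "measure_pmf (bernoulli_pmf (1/2)) \<Otimes>\<^sub>M M"
  let ?k = "\<lambda>(b, x). if b then g x else h x"
  have k[measurable]: "?k \<in> borel_measurable ?P"
    by measurable
  have "(\<integral>x. f x \<partial>distr ?P borel ?k) = (\<integral>p. f (?k p) \<partial>?P)"
    by (rule integral_distr) measurable
  also have "\<dots> = (\<integral>b. (\<integral>x. f (?k (b, x)) \<partial>M) \<partial>bernoulli_pmf (1/2))"
    by (rule P.integral_fst'[symmetric], rule P.P.integrable_const_bound[where B=B])
       (use bounded in auto)
  also have "\<dots> = (1/2) *\<^sub>R (\<integral>x. f (g x) \<partial>M) + (1/2) *\<^sub>R (\<integral>x. f (h x) \<partial>M)"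
    by (subst integral_measure_pmf[of UNIV]) (auto simp: UNIV_bool add.commute)
  finally show ?thesis .
qed

lemma tau_measurable [measurable]:
  "tau_plus \<in> borel_measurable borel" "tau_minus \<in> borel_measurable borel"
  unfolding tau_plus_def[abs_def] tau_minus_def[abs_def] by measurable

text \<open>Turns the setwise condition on \<open>M\<close> into a form that transfers to integrals.
  Taking indicators for \<open>f\<close> in the preceding lemma recovers the setwise
  condition.\<close>

lemma mu_quarter_eq_distr:
  assumes "is_mu_quarter M"
  shows "M = distr (measure_pmf (bernoulli_pmf (1/2)) \<Otimes>\<^sub>M M) borel
            (\<lambda>(b, x). if b then tau_plus x else tau_minus x)" (is "M = ?N")
proof -
  have pM: "prob_space M" and sM[measurable_cong]: "sets M = sets borel"
    using assms by (auto simp: is_mu_quarter_def)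
  interpret M: prob_space M by fact
  interpret P: pair_prob_space "measure_pmf (bernoulli_pmf (1/2))" M ..
  interpret N: prob_space ?N
    by (rule P.P.prob_space_distr) measurable
  show ?thesis
  proof (rule measure_eqI)
    fix A assume "A \<in> sets M"
    then have A[measurable]: "A \<in> sets borel" by (simp add: sM)
    have meas: "measure (distr M borel t) A = (\<integral>x. indicator A (t x) \<partial>M)"
      if [measurable]: "t \<in> borel_measurable borel" for t
    proof -
      have "measure (distr M borel t) A = (\<integral>x. indicator A x \<partial>distr M borel t)"
        by simp
      also have "\<dots> = (\<integral>x. indicator A (t x) \<partial>M)"
        by (rule integral_distr) measurable
      finally show ?thesis .
    qed
    have "measure ?N A = (\<integral>x. indicator A x \<partial>?N)"
      by simp
    also have "\<dots> = (1/2) *\<^sub>R (\<integral>x. indicator A (tau_plus x) \<partial>M)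
        + (1/2) *\<^sub>R (\<integral>x. indicator A (tau_minus x) \<partial>M)"
      by (rule integral_distr_bernoulli_half_pair[OF pM sM, where B=1]) (auto split: split_indicator)
    also have "\<dots> = measure M A"
      using assms A by (simp add: is_mu_quarter_def meas)
    finally show "emeasure M A = emeasure ?N A"
      by (simp add: M.emeasure_eq_measure N.emeasure_eq_measure)
  qed (simp add: sM)
qed

section \<open>Exponentials and the Fourier transform of the measure\<close>

lemma norm_expo [simp]: "norm (expo t x) = 1"
  by (simp add: expo_def norm_exp_eq_Re)

lemma expo_measurable [measurable]: "expo t \<in> borel_measurable borel"
  unfolding expo_def[abs_def] by measurable

text \<open>The contraction divides the frequency by 4 and the shift contributes a constant phase,
  which can leave the integral. The two phases add up to the cosine factor.\<close>

lemma expo_tau: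
  "expo t (tau_plus x) = expo (t/4) x * expo (t/4) 1"
  "expo t (tau_minus x) = expo (t/4) x * expo (t/4) (- 1)"
  unfolding expo_def tau_plus_def tau_minus_def exp_add[symmetric]
  by (rule arg_cong[of _ _ exp]; simp add: field_simps)+

lemma expo_one_add_minus_one: "expo t 1 + expo t (- 1) = of_real (2 * cos (2 * pi * t))"
  by (simp add: expo_def complex_eq_iff Re_exp Im_exp)

lemma mu_quarter_fourier:
  assumes "is_mu_quarter M"
  shows "(\<integral>x. expo t x \<partial>M) = of_real (cos (pi * t / 2)) * (\<integral>x. expo (t/4) x \<partial>M)"
proof -
  have pM: "prob_space M" and sM[measurable_cong]: "sets M = sets borel"
    using assms by (auto simp: is_mu_quarter_def)
  have "(\<integral>x. expo t x \<partial>M) =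
      (1/2) *\<^sub>R (\<integral>x. expo t (tau_plus x) \<partial>M) + (1/2) *\<^sub>R (\<integral>x. expo t (tau_minus x) \<partial>M)"
    by (subst mu_quarter_eq_distr[OF assms],
        rule integral_distr_bernoulli_half_pair[OF pM sM, where B=1]) auto
  also have "\<dots> = (1/2) * (expo (t/4) 1 + expo (t/4) (- 1)) * (\<integral>x. expo (t/4) x \<partial>M)"
    by (simp add: expo_tau scaleR_conv_of_real algebra_simps)
  also have "\<dots> = of_real (cos (pi * t / 2)) * (\<integral>x. expo (t/4) x \<partial>M)"
    by (simp add: expo_one_add_minus_one field_simps)
  finally show ?thesis .
qed

text \<open>\<open>n\<close> ranges over the integers because the frequencies
  \<open>5 * \<gamma> - \<xi>\<close> may be negative.\<close>

lemma mu_quarter_fourier_four_odd: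
  assumes M: "is_mu_quarter M" and "odd (n::int)"
  shows "(\<integral>x. expo (4 * of_int n) x \<partial>M) = 0"
proof -
  have "cos (pi * of_int n / 2) = 0"
    using \<open>odd n\<close> by (auto simp: cos_zero_iff_int)
  then have "(\<integral>x. expo (of_int n) x \<partial>M) = 0"
    by (subst mu_quarter_fourier[OF M]) simp
  then show ?thesis
    by (subst mu_quarter_fourier[OF M]) simp
qed

section \<open>Base-4 digits and the partition of the index set\<close>

lemma Gam_0 [simp]: "0 \<in> Gam"
  unfolding Gam_def by (auto intro!: exI[of _ 0] exI[of _ "\<lambda>_. 0"])

text \<open>Case distinction on the lowest base-4 digit, 0 or 1.\<close>

lemma Gam_decomp: "Gam = (*) 4 ` Gam \<union> Gam0"
proof (intro equalityI subsetI)
  fix x assume "x \<in> Gam"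
  then obtain m a where x: "x = (\<Sum>i\<le>m. a i * 4 ^ i)" and a: "\<forall>i\<le>m. a i \<in> {0, 1::nat}"
    unfolding Gam_def by auto
  \<comment> \<open>\<open>y\<close> drops the lowest digit. For \<open>m = 0\<close> the truncated
    bound \<open>m - 1\<close> still leaves one summand, which the conditional sets to 0.\<close>
  define y where "y = (\<Sum>i\<le>m-1. (if Suc i \<le> m then a (Suc i) else 0) * 4 ^ i)"
  have y: "y \<in> Gam"
    unfolding Gam_def y_def using a
    by (intro CollectI exI[of _ "m - 1"] exI[of _ "\<lambda>i. if Suc i \<le> m then a (Suc i) else 0"]) auto
  have "x = a 0 + 4 * y"
    unfolding x y_def
    by (cases m) (auto simp: sum.atMost_Suc_shift sum_distrib_left mult.left_commute simp del: sum.atMost_Suc)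
  with a y show "x \<in> (*) 4 ` Gam \<union> Gam0"
    unfolding Gam0_def by fastforce
next
  have *: "c + 4 * y \<in> Gam" if "y \<in> Gam" "c \<in> {0, 1}" for c y
  proof -
    from \<open>y \<in> Gam\<close> obtain m a where y: "y = (\<Sum>i\<le>m. a i * 4 ^ i)"
      and a: "\<forall>i\<le>m. a i \<in> {0, 1::nat}"
      unfolding Gam_def by auto
    define b where "b i = (case i of 0 \<Rightarrow> c | Suc j \<Rightarrow> a j)" for i
    have "c + 4 * y = (\<Sum>i\<le>Suc m. b i * 4 ^ i)"
      unfolding y b_def
      by (simp add: sum.atMost_Suc_shift sum_distrib_left mult.left_commute del: sum.atMost_Suc)
    moreover have "\<forall>i\<le>Suc m. b i \<in> {0, 1}"
      using a that by (auto simp: b_def split: nat.split)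
    ultimately show ?thesis
      unfolding Gam_def by blast
  qed
  fix x assume "x \<in> (*) 4 ` Gam \<union> Gam0"
  then show "x \<in> Gam"
    using *[of _ 0] *[of _ 1] by (auto simp: Gam0_def)
qed

text \<open>Trailing zero digits are stripped until the lowest digit is 1; 0 is the only element for
  which this never happens.\<close>

lemma Gam_cases:
  assumes "x \<in> Gam"
  obtains "x = 0" | k \<xi> where "\<xi> \<in> Gam0" "x = 4 ^ k * \<xi>"
proof -
  have "x = 0 \<or> (\<exists>k. \<exists>\<xi>\<in>Gam0. x = 4 ^ k * \<xi>)"
    using assms
  proof (induction x rule: less_induct)
    case (less x)
    from less.prems consider y where "y \<in> Gam" "x = 4 * y" | "x \<in> Gam0"
      using Gam_decomp by auto
    then show ?case
    proof cases
      case 1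
      show ?thesis
      \<comment> \<open>The induction hypothesis requires \<open>y < x\<close>, which fails for
        \<open>y = 0\<close>.\<close>
      proof (cases "y = 0")
        case False
        with 1 less.IH[of y] obtain k \<xi> where "\<xi> \<in> Gam0" "y = 4 ^ k * \<xi>"
          by auto
        with 1 have "x = 4 ^ Suc k * \<xi>" by simp
        with \<open>\<xi> \<in> Gam0\<close> show ?thesis by blast
      qed (use 1 in simp)
    next
      case 2
      then have "x = 4 ^ 0 * x" by simp
      with 2 show ?thesis by blast
    qed
  qed
  with that show thesis by blast
qed

lemma Gam0_subset_Gam: "Gam0 \<subseteq> Gam"
  using Gam_decomp by blast

lemma power_mult_Gam: "x \<in> Gam \<Longrightarrow> 4 ^ k * x \<in> Gam"
proof (induction k)
  case (Suc k)
  then have "4 * (4 ^ k * x) \<in> (*) 4 ` Gam" by blast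
  then show ?case
    using Gam_decomp by (auto simp: mult.assoc)
qed simp

lemma Gam_tilde_subset_Gam0: "Gam_tilde k \<subseteq> Gam0"
proof
  fix x assume "x \<in> Gam_tilde k"
  then obtain \<xi> where "\<xi> \<in> Gam0" "x = 1 + 4 * (4 ^ k * \<xi>)"
    unfolding Gam_tilde_def by (auto simp: mult.assoc)
  then show "x \<in> Gam0"
    using Gam0_subset_Gam power_mult_Gam unfolding Gam0_def by blast
qed

lemma one_in_Gam0: "1 \<in> Gam0"
  unfolding Gam0_def using Gam_0 by force

text \<open>The index \<open>k\<close> counts the zero digits between the lowest digit 1 and the
  next digit 1; the element 1 has no further digit 1.\<close>

lemma Gam0_eq: "Gam0 = {1} \<union> (\<Union>k. Gam_tilde k)"
proof
  show "Gam0 \<subseteq> {1} \<union> (\<Union>k. Gam_tilde k)"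
  proof
    fix x assume "x \<in> Gam0"
    then obtain g where g: "g \<in> Gam" "x = 1 + 4 * g"
      unfolding Gam0_def by blast
    from g(1) show "x \<in> {1} \<union> (\<Union>k. Gam_tilde k)"
    proof (cases rule: Gam_cases)
      case (2 k \<xi>)
      then have "x \<in> Gam_tilde k"
        unfolding Gam_tilde_def using g by (auto simp: mult.assoc)
      then show ?thesis by blast
    qed (use g in simp)
  qed
qed (use one_in_Gam0 Gam_tilde_subset_Gam0 in blast)

lemma odd_Gam0: "\<xi> \<in> Gam0 \<Longrightarrow> odd \<xi>"
  unfolding Gam0_def by auto

lemma one_notin_Gam_tilde: "1 \<notin> Gam_tilde k"
  unfolding Gam_tilde_def using odd_Gam0 by fastforce

lemma four_power_mult_odd_unique:
  fixes x y :: nat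
  assumes "4 ^ i * x = 4 ^ j * y" "odd x" "odd y"
  shows "i = j"
proof -
  have *: "\<not> i < j" if eq: "4 ^ i * x = 4 ^ j * y" and "odd x" for i j x y :: nat
  proof
    assume "i < j"
    then obtain d where "j = Suc (i + d)"
      using less_imp_Suc_add by blast
    with eq have "4 ^ i * x = 4 ^ i * (4 ^ Suc d * y)"
      by (simp add: power_add)
    then have "x = 4 ^ Suc d * y" by simp
    with \<open>odd x\<close> show False by simp
  qed
  show ?thesis
    using *[of i x j y] *[of j y i x] assms by (metis linorder_neqE_nat)
qed

lemma disjoint_Gam_tilde: "disjoint_family Gam_tilde"
  unfolding disjoint_family_on_def
proof (intro ballI impI)
  fix i j :: nat assume "i \<noteq> j"
  show "Gam_tilde i \<inter> Gam_tilde j = {}"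
  proof (rule ccontr)
    assume "Gam_tilde i \<inter> Gam_tilde j \<noteq> {}"
    then obtain x y where "x \<in> Gam0" "y \<in> Gam0" "1 + 4 ^ (i + 1) * x = 1 + 4 ^ (j + 1) * y"
      unfolding Gam_tilde_def by blast
    then have "i + 1 = j + 1"
      using four_power_mult_odd_unique[of "i + 1" x "j + 1" y] odd_Gam0 by auto
    with \<open>i \<noteq> j\<close> show False by simp
  qed
qed

section \<open>Matrix entries as Fourier coefficients, and the zero blocks\<close>

text \<open>Needed to evaluate \<open>restrict U (W0 M)\<close> at a basis vector, since the
  restriction is \<open>undefined\<close> off \<open>W0 M\<close>.\<close>

lemma expo_in_W0:
  assumes "is_mu_quarter M" "\<gamma> \<in> Gam0"
  shows "expo (real \<gamma>) \<in> W0 M"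
proof -
  have pM: "prob_space M" and sM[measurable_cong]: "sets M = sets borel"
    using assms by (auto simp: is_mu_quarter_def)
  interpret prob_space M by fact
  have "expo (real \<gamma>) \<in> L2 M"
    unfolding L2_def by simp
  moreover have "\<exists>F c. finite F \<and> F \<subseteq> (\<lambda>\<gamma>. expo (real \<gamma>)) ` Gam0 \<and>
      L2_norm M (\<lambda>x. expo (real \<gamma>) x - (\<Sum>g\<in>F. c g * g x)) < \<epsilon>" if "\<epsilon> > 0" for \<epsilon>
    using that assms(2) by (intro exI[of _ "{expo (real \<gamma>)}"] exI[of _ "\<lambda>_. 1"]) (simp add: L2_norm_def)
  ultimately show ?thesis
    unfolding W0_def L2_closed_span_def by blast
qed

lemma expo_matrix_eq_fourier:
  assumes M: "is_mu_quarter M"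
    and U: "L2_unitary M U" "AE x in M. U (expo (real \<gamma>)) x = expo (5 * real \<gamma>) x"
    and "\<gamma> \<in> Gam0"
  shows "expo_matrix M (restrict U (W0 M)) \<xi> \<gamma> = (\<integral>x. expo (5 * real \<gamma> - real \<xi>) x \<partial>M)"
proof -
  have sM[measurable_cong]: "sets M = sets borel"
    using M by (auto simp: is_mu_quarter_def)
  have W: "expo (real \<gamma>) \<in> W0 M"
    using expo_in_W0 assms by blast
  \<comment> \<open>\<open>U\<close> is prescribed only almost everywhere, so the integrands are
    compared by \<open>integral_cong_AE\<close>. The measurability this demands comes from
    \<open>U\<close> mapping \<open>L2 M\<close> into itself.\<close>
  then have "expo (real \<gamma>) \<in> L2 M"
    by (simp add: W0_def L2_closed_span_def)
  then have [measurable]: "U (expo (real \<gamma>)) \<in> borel_measurable M"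
    using U(1) by (auto simp: L2_unitary_def L2_def)
  have cnj: "cnj (expo (real \<xi>) x) = expo (- real \<xi>) x" for x
    by (simp add: expo_def exp_cnj)
  have "expo (- real \<xi>) x * expo (5 * real \<gamma>) x = expo (5 * real \<gamma> - real \<xi>) x" for x
    by (simp add: expo_def exp_add[symmetric] algebra_simps)
  then have "AE x in M. expo (- real \<xi>) x * U (expo (real \<gamma>)) x = expo (5 * real \<gamma> - real \<xi>) x"
    using U(2) by auto
  moreover have "(\<lambda>x. expo (- real \<xi>) x * U (expo (real \<gamma>)) x) \<in> borel_measurable M"
    and "expo (5 * real \<gamma> - real \<xi>) \<in> borel_measurable M"
    by measurable
  ultimately show ?thesis
    unfolding expo_matrix_def L2_inner_def restrict_apply'[OF W] cnj
    by (intro integral_cong_AE)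
qed

theorem theorem4p15:
  fixes M :: "real measure"
    and U :: "(real \<Rightarrow> complex) \<Rightarrow> (real \<Rightarrow> complex)"
    and A :: "nat \<Rightarrow> nat \<Rightarrow> complex"
  assumes mu: "is_mu_quarter M"
    and unitary: "L2_unitary M U"
    and U_expo: "\<And>\<gamma>. \<gamma> \<in> Gam \<Longrightarrow> AE x in M. U (expo (real \<gamma>)) x = expo (5 * real \<gamma>) x"
    and A: "A = expo_matrix M (restrict U (W0 M))"
  shows "Gam0 = {1} \<union> (\<Union>k. Gam_tilde k) \<and> (\<forall>k. 1 \<notin> Gam_tilde k) \<and> disjoint_family Gam_tilde \<and>
    zero_block A {1} {1} \<and>
    zero_block A (Gam_tilde 0) (Gam_tilde 0) \<and>
    (\<forall>k\<ge>1. zero_block A {1} (Gam_tilde k) \<and> zero_block A (Gam_tilde k) {1}) \<and>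
    (\<forall>i\<ge>1. \<forall>j\<ge>1. zero_block A (Gam_tilde i) (Gam_tilde j))"
proof -
  \<comment> \<open>The difference is taken in \<open>int\<close>, as subtraction in
    \<open>nat\<close> would truncate.\<close>
  have zero: "A \<xi> \<gamma> = 0" if "\<gamma> \<in> Gam0" "5 * int \<gamma> - int \<xi> = 4 * n" "odd n" for \<xi> \<gamma> n
  proof -
    have "5 * real \<gamma> - real \<xi> = 4 * of_int n"
      using arg_cong[OF that(2), of real_of_int] by simp
    with that show ?thesis
      using expo_matrix_eq_fourier[OF mu unitary U_expo] Gam0_subset_Gam
        mu_quarter_fourier_four_odd[OF mu] unfolding A by auto
  qed
  have G1: "1 \<in> Gam0" and Gk: "\<And>x k. x \<in> Gam_tilde k \<Longrightarrow> x \<in> Gam0"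
    using one_in_Gam0 Gam_tilde_subset_Gam0 by blast+
  \<comment> \<open>For \<open>k \<ge> 1\<close> the factor \<open>4 ^ (k + 1)\<close> is divisible
    by 16.\<close>
  have pos: "\<exists>y. x = 1 + 16 * y" if "x \<in> Gam_tilde k" "k \<ge> 1" for x k
  proof -
    obtain d where "k = Suc d"
      using \<open>k \<ge> 1\<close> by (cases k) auto
    with that(1) show ?thesis
      by (auto simp: Gam_tilde_def)
  qed
  \<comment> \<open>If both indices are 1 modulo 16, then
    \<open>5 * \<gamma> - \<xi> = 4 * (1 + 20 * z - 4 * y)\<close> with odd cofactor. This handles 1
    and all \<open>Gam_tilde k\<close> with \<open>k \<ge> 1\<close> together.\<close>
  have low: "zero_block A R C"
    if C: "C \<subseteq> Gam0" and RC: "\<And>x. x \<in> R \<union> C \<Longrightarrow> \<exists>y. x = 1 + 16 * y" for R C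
    unfolding zero_block_def
  proof (intro ballI)
    fix \<xi> \<gamma> assume "\<xi> \<in> R" "\<gamma> \<in> C"
    then obtain y z where "\<xi> = 1 + 16 * y" "\<gamma> = 1 + 16 * z"
      using RC by blast
    then show "A \<xi> \<gamma> = 0"
      using \<open>\<gamma> \<in> C\<close> C by (intro zero[where n = "1 + 20 * int z - 4 * int y"]) auto
  qed
  \<comment> \<open>Elements of \<open>Gam_tilde 0\<close> are 5 modulo 16, and the cofactor
    \<open>5 + 20 * z - 4 * y\<close> is again odd. With exactly one index in
    \<open>Gam_tilde 0\<close> the cofactor would be even, so the argument leaves those blocks
    open.\<close>
  have "zero_block A (Gam_tilde 0) (Gam_tilde 0)"
    unfolding zero_block_def
  proof (intro ballI)
    fix \<xi> \<gamma> assume *: "\<xi> \<in> Gam_tilde 0" "\<gamma> \<in> Gam_tilde 0"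
    then obtain y z where "\<xi> = 5 + 16 * y" "\<gamma> = 5 + 16 * z"
      by (auto simp: Gam_tilde_def Gam0_def)
    then show "A \<xi> \<gamma> = 0"
      using * Gk by (intro zero[where n = "5 + 20 * int z - 4 * int y"]) auto
  qed
  moreover have "zero_block A {1} {1}"
    by (rule low) (use G1 in auto)
  moreover have "zero_block A {1} (Gam_tilde k)" "zero_block A (Gam_tilde k) {1}" if "k \<ge> 1" for k
    by (rule low; use G1 Gk pos that in force)+
  moreover have "zero_block A (Gam_tilde i) (Gam_tilde j)" if "i \<ge> 1" "j \<ge> 1" for i j
    by (rule low; use Gk pos that in blast)
  ultimately show ?thesis
    using Gam0_eq one_notin_Gam_tilde disjoint_Gam_tilde by blast
qed

end
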